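(* Let $D\ge 1$ and let $M_1,\dots,M_D$ be positive integers, $N=\prod_{d=1}^{D}M_d$, and $p_1,\dots,p_D\in[0,1]$ with $\gamma=\sum_{d=1}^{D}p_d(M_d-1)>0$. Let $\mathcal{G}_{\mathrm{lat}}$ be the $D$-dimensional lattice graph on $N$ nodes with size $M_d$ along dimension $d$, whose adjacency matrix is $$A(\mathcal{G}_{\mathrm{lat}})=\sum_{j=1}^{D}\bigotimes_{d=1}^{D}X_{dj},\qquad X_{dj}=\begin{cases}K_{M_d}& j=d\\ I_{M_d}& j\neq d.\end{cases}$$ Let $\mathcal{G}_{\mathrm{perc}}$ be the random graph obtained by independently including each link of $\mathcal{G}_{\mathrm{lat}}$ along lattice dimension $d$ with probability $p_d$. Let $W=\frac{1}{\gamma}A(\mathcal{G}_{\mathrm{perc}})$, where $\gamma$ is the expected node degree, and let $B=\operatorname{E}[W]$ and $H=W-\operatorname{E}[W]$. For $\operatorname{Im}\{z\}\neq 0$, let $C_{kk}(z)$, $k=1,\dots,N$, be the unique solution in the class $L$ of the canonical system of equations $$C_{kk}(z)=\left[\left(B-zI_N-\left(\delta_{lj}\sum_{s=1}^{N}C_{ss}(z)\operatorname{E}[H_{js}^2]\right)_{l,j=1}^{l,j=N}\right)^{-1}\right]_{kk},\qquad k=1,\dots,N,$$ and let $$C(z)=\left(B-zI_N-\left(\delta_{lj}\sum_{s=1}^{N}C_{ss}(z)\operatorname{E}[H_{js}^2]\right)_{l,j=1}^{l,j=N}\right)^{-1},$$ so that $C_{kk}(z)$ is the $k$th diagonal entry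 of $C(z)$. Then there exist complex values $\alpha_{i_1,\dots,i_D}(z)$, $i_1,\dots,i_D\in\{0,1\}$, such that $$C(z)=\sum_{i_1,\dots,i_D=0}^{1}\alpha_{i_1,\dots,i_D}(z)\bigotimes_{d=1}^{D}Y_{di_d},\qquad Y_{di_d}=\begin{cases}K_{M_d}& i_d=0\\ I_{M_d}& i_d=1.\end{cases}$$
   Context: Here $I_M$ is the $M\times M$ identity matrix and $K_M$ is the adjacency matrix of the complete graph on $M$ nodes (zeros on the diagonal, ones elsewhere). The nodes of the $D$-dimensional lattice graph are the ordered $D$-tuples whose $d$th entry takes one of $M_d$ symbols; two nodes are linked iff their tuples differ in exactly one entry, and the link is "along lattice dimension $d$" if the tuples differ in the $d$th entry (equivalently, the link corresponds to a nonzero entry of the $j=d$ summand in the Kronecker product formula for $A(\mathcal{G}_{\mathrm{lat}})$). Nodes are ordered compatibly with that Kronecker product formula. Links are undirected, so the random adjacency matrix $A(\mathcal{G}_{\mathrm{perc}})$ is symmetric, with independent entries on the upper triangle. $\left(X_{lj}\right)_{l,j=1}^{l,j=N}$ denotes the $N\times N$ matrix with entries $X_{lj}$, and $\delta_{lj}$ is the Kronecker delta. The class $L$ is the set of complex-valued functions $X(z)$, analytic on $\{z\in\mathbb{C}:\operatorname{Im}\{z\}\neq 0\}$, with $\operatorname{Im}\{z\}\operatorname{Im}\{X(z)\}>0$. It is a known theorem (Girko's K1 equation) that the canonical system has a unique solution with $C_{kk}\in L$ for all $k=1,\dots,N$. *)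

theory Defs
  imports
    "HOL-Probability.Probability"
    "Jordan_Normal_Form.Gauss_Jordan_Elimination"
begin

section \<open>Kronecker products\<close>

definition kron :: "'a::comm_semiring_1 mat \<Rightarrow> 'a mat \<Rightarrow> 'a mat" where
  "kron A B = mat (dim_row A * dim_row B) (dim_col A * dim_col B)
     (\<lambda>(i, j). A $$ (i div dim_row B, j div dim_col B) * B $$ (i mod dim_row B, j mod dim_col B))"

text \<open>The lattice dimensions are numbered \<open>0, \<dots>, D - 1\<close>, and \<open>kron_prod X D\<close> is
  \<open>X 0 \<otimes> X 1 \<otimes> \<cdots> \<otimes> X (D - 1)\<close>.\<close>

primrec kron_prod :: "(nat \<Rightarrow> 'a::comm_semiring_1 mat) \<Rightarrow> nat \<Rightarrow> 'a mat" where
  "kron_prod X 0 = 1\<^sub>m 1"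
| "kron_prod X (Suc D) = kron (kron_prod X D) (X D)"

definition mat_sum :: "nat \<Rightarrow> 'i set \<Rightarrow> ('i \<Rightarrow> 'a::comm_monoid_add mat) \<Rightarrow> 'a mat" where
  "mat_sum n I X = mat n n (\<lambda>(l, j). \<Sum>i\<in>I. X i $$ (l, j))"

definition complete_adj :: "nat \<Rightarrow> 'a::zero_neq_one mat" where
  "complete_adj m = mat m m (\<lambda>(i, j). if i = j then 0 else 1)"


section \<open>The lattice graph\<close>

text \<open>The node with index \<open>k < (\<Prod>d<D. M d)\<close> is the tuple of the mixed-radix digits of \<open>k\<close>, the
  most significant digit belonging to dimension \<open>0\<close>. This is the node ordering that goes with
  \<^const>\<open>kron_prod\<close>; see \<open>bij_betw_coord\<close> and \<open>adjacency_mat_lattice\<close> below.\<close>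

definition coord :: "(nat \<Rightarrow> nat) \<Rightarrow> nat \<Rightarrow> nat \<Rightarrow> nat \<Rightarrow> nat" where
  "coord M D d k = (k div (\<Prod>e\<in>{d<..<D}. M e)) mod M d"

definition lattice_links :: "(nat \<Rightarrow> nat) \<Rightarrow> nat \<Rightarrow> nat \<Rightarrow> nat set set" where
  "lattice_links M D d = {{l, j} | l j. l < (\<Prod>e<D. M e) \<and> j < (\<Prod>e<D. M e) \<and>
      {e. e < D \<and> coord M D e l \<noteq> coord M D e j} = {d}}"

definition adjacency_mat :: "nat \<Rightarrow> nat set set \<Rightarrow> 'a::zero_neq_one mat" where
  "adjacency_mat n E = mat n n (\<lambda>(l, j). if {l, j} \<in> E then 1 else 0)"

lemma coord_less: "M d > 0 \<Longrightarrow> coord M D d k < M d"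
  by (simp add: coord_def)

lemma coord_last: "coord M (Suc D) D k = k mod M D"
proof -
  have "{D<..<Suc D} = {}" by auto
  then show ?thesis by (simp add: coord_def)
qed

lemma coord_Suc:
  assumes "d < D"
  shows "coord M (Suc D) d k = coord M D d (k div M D)"
proof -
  have "{d<..<Suc D} = insert D {d<..<D}" using assms by auto
  then have "(\<Prod>e\<in>{d<..<Suc D}. M e) = M D * (\<Prod>e\<in>{d<..<D}. M e)" by simp
  then show ?thesis by (simp add: coord_def div_mult2_eq)
qed

lemma coord_eqI:
  assumes "k < (\<Prod>d<D. M d)" "k' < (\<Prod>d<D. M d)" "\<And>d. d < D \<Longrightarrow> coord M D d k = coord M D d k'"
  shows "k = k'"
  using assms
proof (induction D arbitrary: k k')
  case 0
  then show ?case by simp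
next
  case (Suc D)
  have "k div M D = k' div M D"
  proof (rule Suc.IH)
    show "k div M D < (\<Prod>d<D. M d)" "k' div M D < (\<Prod>d<D. M d)"
      using Suc.prems(1,2) by (auto intro: less_mult_imp_div_less)
    show "coord M D d (k div M D) = coord M D d (k' div M D)" if "d < D" for d
      using Suc.prems(3)[of d] that by (simp add: coord_Suc)
  qed
  moreover have "k mod M D = k' mod M D"
    using Suc.prems(3)[of D] by (simp add: coord_last)
  ultimately show ?case by (metis div_mult_mod_eq)
qed

lemma bij_betw_coord:
  assumes "\<And>d. d < D \<Longrightarrow> M d > 0"
  shows "bij_betw (\<lambda>k. \<lambda>d\<in>{..<D}. coord M D d k) {..<\<Prod>d<D. M d} (\<Pi>\<^sub>E d\<in>{..<D}. {..<M d})"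
proof -
  let ?f = "\<lambda>k. \<lambda>d\<in>{..<D}. coord M D d k"
  have inj: "inj_on ?f {..<\<Prod>d<D. M d}"
  proof (rule inj_onI)
    fix k k' assume k: "k \<in> {..<\<Prod>d<D. M d}" "k' \<in> {..<\<Prod>d<D. M d}" and eq: "?f k = ?f k'"
    have "coord M D d k = coord M D d k'" if "d < D" for d
      using fun_cong[OF eq, of d] that by simp
    with k show "k = k'" using coord_eqI[of k M D k'] by auto
  qed
  moreover have "?f ` {..<\<Prod>d<D. M d} = (\<Pi>\<^sub>E d\<in>{..<D}. {..<M d})"
  proof (rule card_subset_eq)
    show "finite (\<Pi>\<^sub>E d\<in>{..<D}. {..<M d})" by (intro finite_PiE) auto
    show "?f ` {..<\<Prod>d<D. M d} \<subseteq> (\<Pi>\<^sub>E d\<in>{..<D}. {..<M d})"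
      by (rule image_subsetI, subst restrict_PiE_iff) (use assms in \<open>simp add: coord_less\<close>)
    show "card (?f ` {..<\<Prod>d<D. M d}) = card (\<Pi>\<^sub>E d\<in>{..<D}. {..<M d})"
      using inj by (simp add: card_image card_PiE)
  qed
  ultimately show ?thesis by (simp add: bij_betw_def)
qed

lemma dim_kron_prod:
  assumes "\<And>d. d < D \<Longrightarrow> X d \<in> carrier_mat (M d) (M d)"
  shows "kron_prod X D \<in> carrier_mat (\<Prod>d<D. M d) (\<Prod>d<D. M d)"
  using assms
proof (induction D)
  case (Suc D)
  then have "kron_prod X D \<in> carrier_mat (\<Prod>d<D. M d) (\<Prod>d<D. M d)" "X D \<in> carrier_mat (M D) (M D)"
    by auto
  then show ?case by (simp add: kron_def)
qed simp

lemma kron_prod_entry: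
  assumes "\<And>d. d < D \<Longrightarrow> X d \<in> carrier_mat (M d) (M d)"
    and "l < (\<Prod>d<D. M d)" "j < (\<Prod>d<D. M d)"
  shows "kron_prod X D $$ (l, j) = (\<Prod>d<D. X d $$ (coord M D d l, coord M D d j))"
  using assms
proof (induction D arbitrary: l j)
  case 0
  then show ?case by simp
next
  case (Suc D)
  have car: "kron_prod X D \<in> carrier_mat (\<Prod>d<D. M d) (\<Prod>d<D. M d)"
    by (rule dim_kron_prod) (use Suc.prems in auto)
  have X: "X D \<in> carrier_mat (M D) (M D)" using Suc.prems by auto
  have "kron_prod X (Suc D) $$ (l, j)
      = kron_prod X D $$ (l div M D, j div M D) * X D $$ (l mod M D, j mod M D)"
    using car X Suc.prems(2,3) by (simp add: kron_def)
  also have "kron_prod X D $$ (l div M D, j div M D)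
      = (\<Prod>d<D. X d $$ (coord M D d (l div M D), coord M D d (j div M D)))"
    by (rule Suc.IH) (use Suc.prems in \<open>auto intro: less_mult_imp_div_less\<close>)
  also have "\<dots> = (\<Prod>d<D. X d $$ (coord M (Suc D) d l, coord M (Suc D) d j))"
    by (rule prod.cong) (auto simp: coord_Suc)
  finally show ?case by (simp add: coord_last)
qed

lemma doubleton_in_lattice_links:
  assumes "l < (\<Prod>d<D. M d)" "j < (\<Prod>d<D. M d)"
  shows "{l, j} \<in> lattice_links M D d \<longleftrightarrow> {e. e < D \<and> coord M D e l \<noteq> coord M D e j} = {d}"
proof
  assume "{l, j} \<in> lattice_links M D d"
  then obtain l' j' where *: "{l, j} = {l', j'}"
    "{e. e < D \<and> coord M D e l' \<noteq> coord M D e j'} = {d}"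
    unfolding lattice_links_def by blast
  then have "l = l' \<and> j = j' \<or> l = j' \<and> j = l'" by (auto simp: doubleton_eq_iff)
  moreover have "{e. e < D \<and> coord M D e j' \<noteq> coord M D e l'} = {d}"
    using *(2) by (simp only: eq_commute[of "coord M D _ j'"])
  ultimately show "{e. e < D \<and> coord M D e l \<noteq> coord M D e j} = {d}"
    using *(2) by (elim disjE conjE) simp_all
qed (use assms in \<open>unfold lattice_links_def, blast\<close>)

lemma adjacency_mat_lattice_links:
  assumes "c < D"
  shows "adjacency_mat (\<Prod>d<D. M d) (lattice_links M D c)
       = (kron_prod (\<lambda>d. if d = c then complete_adj (M d) else 1\<^sub>m (M d)) D
            :: 'a::{comm_semiring_1} mat)"
    (is "?A = kron_prod ?X D")
proof -
  let ?N = "\<Prod>d<D. M d"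
  have X: "?X d \<in> carrier_mat (M d) (M d)" for d by (simp add: complete_adj_def)
  have car: "kron_prod ?X D \<in> carrier_mat ?N ?N" by (rule dim_kron_prod) (rule X)
  show ?thesis
  proof (rule eq_matI)
    fix l j assume "l < dim_row (kron_prod ?X D)" "j < dim_col (kron_prod ?X D)"
    then have lj: "l < ?N" "j < ?N" using car by auto
    have pos: "M d > 0" if "d < D" for d
    proof (rule ccontr)
      assume "\<not> M d > 0"
      then have "?N = 0" using that by (auto intro!: prod_zero)
      then show False using lj(1) by (metis not_less0)
    qed
    let ?S = "{e. e < D \<and> coord M D e l \<noteq> coord M D e j}"
    have "kron_prod ?X D $$ (l, j) = (\<Prod>d<D. ?X d $$ (coord M D d l, coord M D d j))"
      by (rule kron_prod_entry) (use X lj in auto)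
    also have "\<dots> = (\<Prod>d<D. if (d \<in> ?S) = (d = c) then 1 else 0)"
      by (rule prod.cong) (auto simp: complete_adj_def coord_less pos)
    also have "\<dots> = (if ?S = {c} then 1 else 0)"
    proof (cases "?S = {c}")
      case True
      then have "(d \<in> ?S) = (d = c)" for d by blast
      then show ?thesis using True by simp
    next
      case False
      then obtain d where "d < D" "(d \<in> ?S) \<noteq> (d = c)" using assms by blast
      then show ?thesis using False by (auto intro!: prod_zero bexI[of _ d])
    qed
    finally show "?A $$ (l, j) = kron_prod ?X D $$ (l, j)"
      using lj by (simp add: adjacency_mat_def doubleton_in_lattice_links)
  qed (use car in \<open>simp_all add: adjacency_mat_def\<close>)
qed

lemma adjacency_mat_lattice:
  "adjacency_mat (\<Prod>d<D. M d) (\<Union>c<D. lattice_links M D c)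
   = mat_sum (\<Prod>d<D. M d) {..<D}
       (\<lambda>c. kron_prod (\<lambda>d. if d = c then complete_adj (M d) else 1\<^sub>m (M d)) D
            :: 'a::{comm_semiring_1} mat)"
    (is "?A = ?S")
proof (rule eq_matI)
  let ?N = "\<Prod>d<D. M d"
  fix l j assume "l < dim_row ?S" "j < dim_col ?S"
  then have lj: "l < ?N" "j < ?N" by (auto simp: mat_sum_def)
  have "?S $$ (l, j) = (\<Sum>c<D. adjacency_mat ?N (lattice_links M D c) $$ (l, j))"
    using lj by (simp add: mat_sum_def adjacency_mat_lattice_links)
  also have "\<dots> = (\<Sum>c<D. if {l, j} \<in> lattice_links M D c then 1 else 0)"
    using lj by (simp add: adjacency_mat_def)
  also have "\<dots> = (if {l, j} \<in> (\<Union>c<D. lattice_links M D c) then 1 else 0)"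
  proof (cases "{l, j} \<in> (\<Union>c<D. lattice_links M D c)")
    case True
    then obtain c where c: "c < D" "{l, j} \<in> lattice_links M D c" by blast
    have "{l, j} \<in> lattice_links M D e \<longleftrightarrow> e = c" for e
      using c(2) lj by (auto simp: doubleton_in_lattice_links)
    then show ?thesis using True c by simp
  qed simp
  finally show "?A $$ (l, j) = ?S $$ (l, j)"
    using lj by (simp add: adjacency_mat_def)
qed (simp_all add: adjacency_mat_def mat_sum_def)


section \<open>Percolation of the lattice graph\<close>

text \<open>\<open>G\<close> is the random set of links that are kept.\<close>

definition lattice_percolation ::
    "'w measure \<Rightarrow> (nat \<Rightarrow> nat) \<Rightarrow> nat \<Rightarrow> (nat \<Rightarrow> real) \<Rightarrow> ('w \<Rightarrow> nat set set) \<Rightarrow> bool" where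
  "lattice_percolation P M D p G \<longleftrightarrow>
     prob_space P \<and>
     (\<forall>\<omega>\<in>space P. G \<omega> \<subseteq> (\<Union>d<D. lattice_links M D d)) \<and>
     prob_space.indep_events P (\<lambda>e. {\<omega>\<in>space P. e \<in> G \<omega>}) (\<Union>d<D. lattice_links M D d) \<and>
     (\<forall>d<D. \<forall>e\<in>lattice_links M D d. measure P {\<omega>\<in>space P. e \<in> G \<omega>} = p d)"

definition expectation_mat :: "'w measure \<Rightarrow> nat \<Rightarrow> ('w \<Rightarrow> real mat) \<Rightarrow> real mat" where
  "expectation_mat P n X = mat n n (\<lambda>(l, j). integral\<^sup>L P (\<lambda>\<omega>. X \<omega> $$ (l, j)))"


section \<open>The canonical system of equations\<close>

definition class_L :: "(complex \<Rightarrow> complex) set" where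
  "class_L = {X. X analytic_on {z. Im z \<noteq> 0} \<and> (\<forall>z. Im z \<noteq> 0 \<longrightarrow> Im z * Im (X z) > 0)}"

text \<open>\<open>canonical_mat P n B H c z\<close> is the matrix that is inverted in the canonical system; node
  indices run over \<open>0, \<dots>, n - 1\<close>.\<close>

definition canonical_mat ::
    "'w measure \<Rightarrow> nat \<Rightarrow> real mat \<Rightarrow> ('w \<Rightarrow> real mat) \<Rightarrow> (nat \<Rightarrow> complex \<Rightarrow> complex) \<Rightarrow> complex \<Rightarrow> complex mat"
  where
  "canonical_mat P n B H c z =
     map_mat complex_of_real B - z \<cdot>\<^sub>m 1\<^sub>m n
     - mat n n (\<lambda>(l, j). if l = j
         then \<Sum>s<n. c s z * complex_of_real (integral\<^sup>L P (\<lambda>\<omega>. (H \<omega> $$ (j, s))\<^sup>2)) else 0)"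

definition canonical_solution ::
    "'w measure \<Rightarrow> nat \<Rightarrow> real mat \<Rightarrow> ('w \<Rightarrow> real mat) \<Rightarrow> (nat \<Rightarrow> complex \<Rightarrow> complex) \<Rightarrow> bool" where
  "canonical_solution P n B H c \<longleftrightarrow>
     (\<forall>k<n. c k \<in> class_L) \<and>
     (\<forall>z. Im z \<noteq> 0 \<longrightarrow> invertible_mat (canonical_mat P n B H c z) \<and>
        (\<forall>k<n. c k z = the (mat_inverse (canonical_mat P n B H c z)) $$ (k, k)))"

end

theory Submission
  imports
    Defs
    "HOL-Complex_Analysis.Conformal_Mappings"
    "HOL-Combinatorics.Transposition"
begin

text \<open>Only the uniqueness half of Girko's theorem is needed. If \<open>X\<close> inverts
  \<open>B - diag g\<close> with \<open>B\<close> real symmetric and \<open>Im g\<close> of one sign and at least \<open>t > 0\<close> in modulus, then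
  the entries of \<open>X\<close> are at most \<open>1 / t\<close>. With the resolvent identity this makes the canonical system
  a contraction for large \<open>\<bar>Im z\<bar>\<close>, so two solutions in the class \<open>L\<close> agree there, and by the
  identity theorem on both half planes.

  The means and variances of the entries depend only on the set of dimensions in which two nodes
  differ, so permuting the symbols in each dimension maps a solution to a solution. By uniqueness
  \<open>C z\<close> is invariant under these permutations, whose orbits on pairs of nodes are exactly the
  supports of the \<open>2 ^ D\<close> Kronecker products.\<close>

section \<open>Uniqueness for the canonical system\<close>

text \<open>Entry functions replace matrices here, so that a permutation of the nodes acts by
  composition. Values at indices outside \<open>{..<n}\<close> are irrelevant.\<close>

definition inverse_entries :: "nat \<Rightarrow> (nat \<Rightarrow> nat \<Rightarrow> complex) \<Rightarrow> (nat \<Rightarrow> nat \<Rightarrow> complex) \<Rightarrow> bool" where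
  "inverse_entries n A X \<longleftrightarrow> (\<forall>l<n. \<forall>j<n.
     (\<Sum>m<n. A l m * X m j) = (if l = j then 1 else 0) \<and>
     (\<Sum>m<n. X l m * A m j) = (if l = j then 1 else 0))"

definition canonical_entries ::
    "nat \<Rightarrow> (nat \<Rightarrow> nat \<Rightarrow> real) \<Rightarrow> (nat \<Rightarrow> nat \<Rightarrow> real) \<Rightarrow> (nat \<Rightarrow> complex) \<Rightarrow> complex \<Rightarrow> nat \<Rightarrow> nat \<Rightarrow> complex"
  where
  "canonical_entries n B v c z l j =
     of_real (B l j) - (if l = j then z + (\<Sum>s<n. c s * of_real (v j s)) else 0)"

text \<open>The inverse \<open>X\<close> is kept next to \<open>c\<close> because uniqueness and
  symmetry are wanted for its off-diagonal entries too, whereas the system itself mentions only the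
  diagonal.\<close>

definition canonical_pair ::
    "nat \<Rightarrow> (nat \<Rightarrow> nat \<Rightarrow> real) \<Rightarrow> (nat \<Rightarrow> nat \<Rightarrow> real) \<Rightarrow> (nat \<Rightarrow> complex \<Rightarrow> complex) \<Rightarrow>
      (complex \<Rightarrow> nat \<Rightarrow> nat \<Rightarrow> complex) \<Rightarrow> bool" where
  "canonical_pair n B v c X \<longleftrightarrow>
     (\<forall>k<n. c k \<in> class_L) \<and>
     (\<forall>z. Im z \<noteq> 0 \<longrightarrow> inverse_entries n (canonical_entries n B v (\<lambda>s. c s z) z) (X z) \<and>
        (\<forall>k<n. c k z = X z k k))"

text \<open>Expand X (A' - A) Y and use A' Y = I in the first part, X A = I in the second.\<close>

lemma inverse_entries_resolvent_identity:
  assumes X: "inverse_entries n A X" and Y: "inverse_entries n A' Y" and "k < n" "j < n"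
  shows "X k j - Y k j = (\<Sum>l<n. \<Sum>m<n. X k l * (A' l m - A l m) * Y m j)"
proof -
  have "(\<Sum>l<n. \<Sum>m<n. X k l * (A' l m - A l m) * Y m j)
      = (\<Sum>l<n. X k l * (\<Sum>m<n. A' l m * Y m j)) - (\<Sum>l<n. \<Sum>m<n. X k l * A l m * Y m j)"
    by (simp add: algebra_simps sum_subtractf sum_distrib_left)
  also have "(\<Sum>l<n. X k l * (\<Sum>m<n. A' l m * Y m j)) = (\<Sum>l<n. X k l * (if l = j then 1 else 0))"
    using Y \<open>j < n\<close> by (intro sum.cong) (auto simp: inverse_entries_def)
  also have "\<dots> = X k j"
    using \<open>j < n\<close> by (simp add: if_distrib cong: if_cong)
  also have "(\<Sum>l<n. \<Sum>m<n. X k l * A l m * Y m j) = (\<Sum>m<n. (\<Sum>l<n. X k l * A l m) * Y m j)"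
    by (subst sum.swap) (simp add: sum_distrib_right)
  also have "\<dots> = (\<Sum>m<n. (if k = m then 1 else 0) * Y m j)"
    using X \<open>k < n\<close> by (intro sum.cong) (auto simp: inverse_entries_def)
  also have "\<dots> = Y k j"
    using \<open>k < n\<close> by (simp add: if_distrib[of "\<lambda>x. x * _"] cong: if_cong)
  finally show ?thesis by simp
qed

lemma inverse_entries_unique:
  assumes "inverse_entries n A X" "inverse_entries n A Y" "k < n" "j < n"
  shows "X k j = Y k j"
  using inverse_entries_resolvent_identity[OF assms] by simp

text \<open>Here \<open>y\<close> is column \<open>j\<close> of the inverse. Pairing its equation
  with the conjugate of \<open>y\<close> makes the \<open>B\<close> part real, so the imaginary part
  gives \<open>Im (y j)\<close> as the sum of the \<open>Im (g l)\<close> with weights |y_l|^2. All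
  terms have the sign \<open>s\<close>, hence each t |y_i|^2 is at most |y_j|.\<close>

lemma norm_resolvent_entry_le:
  fixes B :: "nat \<Rightarrow> nat \<Rightarrow> real" and g y :: "nat \<Rightarrow> complex"
  assumes sym: "\<And>l m. l < n \<Longrightarrow> m < n \<Longrightarrow> B l m = B m l"
    and y: "\<And>l. l < n \<Longrightarrow>
      (\<Sum>m<n. (of_real (B l m) - (if l = m then g m else 0)) * y m) = (if l = j then 1 else 0)"
    and s: "\<bar>s\<bar> = 1" and t: "t > 0" "\<And>i. i < n \<Longrightarrow> t \<le> s * Im (g i)"
    and "j < n" "k < n"
  shows "norm (y k) \<le> 1 / t"
proof -
  let ?q = "\<Sum>l<n. \<Sum>m<n. of_real (B l m) * (cnj (y l) * y m)"
  have "cnj (y j) = (\<Sum>l<n. cnj (y l) * (if l = j then 1 else 0))"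
    using \<open>j < n\<close> by (simp add: if_distrib cong: if_cong)
  also have "\<dots> = (\<Sum>l<n. cnj (y l) *
      (\<Sum>m<n. (of_real (B l m) - (if l = m then g m else 0)) * y m))"
    by (intro sum.cong) (simp_all add: y)
  also have "\<dots> = (\<Sum>l<n. \<Sum>m<n. of_real (B l m) * (cnj (y l) * y m)
      - (if l = m then g m * (cnj (y l) * y m) else 0))"
    by (simp add: sum_distrib_left algebra_simps if_distrib cong: if_cong)
       (auto intro!: sum.cong simp: algebra_simps)
  also have "\<dots> = ?q - (\<Sum>l<n. g l * (cnj (y l) * y l))"
    by (simp add: sum_subtractf)
  also have "(\<Sum>l<n. g l * (cnj (y l) * y l)) = (\<Sum>l<n. g l * of_real ((norm (y l))\<^sup>2))"
    by (intro sum.cong refl) (simp only: complex_norm_square mult.commute)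
  finally have eq: "cnj (y j) = ?q - (\<Sum>l<n. g l * of_real ((norm (y l))\<^sup>2))" .
  \<comment> \<open>Symmetry of \<open>B\<close> and an exchange of the two summations make
    \<open>?q\<close> its own conjugate.\<close>
  have "cnj ?q = (\<Sum>l<n. \<Sum>m<n. of_real (B l m) * (y l * cnj (y m)))"
    by simp
  also have "\<dots> = (\<Sum>m<n. \<Sum>l<n. of_real (B l m) * (y l * cnj (y m)))"
    by (rule sum.swap)
  also have "\<dots> = ?q"
    by (intro sum.cong) (auto simp: sym mult.commute)
  finally have "Im ?q = 0"
    using arg_cong[of "cnj ?q" ?q Im] unfolding cnj.sel by linarith
  moreover have "Im (\<Sum>l<n. g l * of_real ((norm (y l))\<^sup>2)) = (\<Sum>l<n. Im (g l) * (norm (y l))\<^sup>2)"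
    unfolding Im_sum by (intro sum.cong refl) (simp only: times_complex.sel Re_complex_of_real
        Im_complex_of_real mult_zero_right add_0)
  ultimately have Im_y: "Im (y j) = (\<Sum>l<n. Im (g l) * (norm (y l))\<^sup>2)"
    using arg_cong[OF eq, of Im] unfolding minus_complex.sel cnj.sel by linarith
  have le: "t * (norm (y i))\<^sup>2 \<le> norm (y j)" if "i < n" for i
  proof -
    have "t * (norm (y i))\<^sup>2 \<le> (\<Sum>l<n. t * (norm (y l))\<^sup>2)"
      using that t(1) by (intro member_le_sum) auto
    also have "\<dots> \<le> (\<Sum>l<n. s * Im (g l) * (norm (y l))\<^sup>2)"
      using t(2) by (intro sum_mono mult_right_mono) auto
    also have "\<dots> = s * Im (y j)"
      by (simp add: Im_y sum_distrib_left mult.assoc)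
    also have "\<dots> \<le> norm (y j)"
      using s abs_Im_le_cmod[of "y j"] by (metis abs_ge_self abs_mult mult_1 order_trans)
    finally show ?thesis .
  qed
  \<comment> \<open>The case \<open>i = j\<close> of \<open>le\<close> bounds the diagonal entry;
    put back into \<open>le\<close>, this bounds the whole column.\<close>
  have yj: "norm (y j) \<le> 1 / t"
  proof (cases "y j = 0")
    case False
    have "(t * norm (y j)) * norm (y j) \<le> 1 * norm (y j)"
      using le[OF \<open>j < n\<close>] by (simp add: power2_eq_square mult.assoc)
    then have "t * norm (y j) \<le> 1"
      using False by (simp only: mult_le_cancel_right) auto
    then show ?thesis using t(1) by (simp add: field_simps)
  qed (use t in simp)
  have "t * (norm (y k))\<^sup>2 \<le> 1 / t"
    using le[OF \<open>k < n\<close>] yj by linarith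
  then have "(norm (y k))\<^sup>2 \<le> (1 / t)\<^sup>2"
    using t(1) by (simp add: field_simps power2_eq_square)
  then show ?thesis
    by (rule power2_le_imp_le) (use t(1) in simp)
qed

text \<open>In the class L, \<open>Im (c s z)\<close> has the sign of \<open>Im z\<close>. With
  nonnegative weights \<open>v\<close>, the sum added to \<open>z\<close> only moves it further from
  the real axis, so t = \<bar>Im z\<bar> is admissible.\<close>

lemma canonical_pair_entry_bound:
  assumes c: "canonical_pair n B v c X"
    and sym: "\<And>l m. l < n \<Longrightarrow> m < n \<Longrightarrow> B l m = B m l"
    and v: "\<And>l m. v l m \<ge> 0"
    and "Im z \<noteq> 0" "k < n" "j < n"
  shows "norm (X z k j) \<le> 1 / \<bar>Im z\<bar>"
proof -
  let ?g = "\<lambda>j. z + (\<Sum>s<n. c s z * of_real (v j s))"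
  show ?thesis
  proof (rule norm_resolvent_entry_le[where y = "\<lambda>k. X z k j" and g = ?g and s = "sgn (Im z)"])
    show "(\<Sum>m<n. (of_real (B l m) - (if l = m then ?g m else 0)) * X z m j) = (if l = j then 1 else 0)"
      if "l < n" for l
      using c that \<open>j < n\<close> \<open>Im z \<noteq> 0\<close>
      by (simp add: canonical_pair_def inverse_entries_def canonical_entries_def)
    show "\<bar>sgn (Im z)\<bar> = 1" "\<bar>Im z\<bar> > 0"
      using \<open>Im z \<noteq> 0\<close> by (auto simp: sgn_if)
    show "\<bar>Im z\<bar> \<le> sgn (Im z) * Im (?g i)" if "i < n" for i
    proof -
      have "0 \<le> sgn (Im z) * Im (c s z)" if "s < n" for s
      proof -
        have "Im z * Im (c s z) > 0"
          using c that \<open>Im z \<noteq> 0\<close> by (auto simp: canonical_pair_def class_L_def)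
        then show ?thesis
          by (auto simp: sgn_if zero_less_mult_iff)
      qed
      then have "0 \<le> (\<Sum>s<n. sgn (Im z) * Im (c s z) * v i s)"
        using v by (intro sum_nonneg mult_nonneg_nonneg[OF _ v]) auto
      moreover have "sgn (Im z) * Im (?g i) = \<bar>Im z\<bar> + (\<Sum>s<n. sgn (Im z) * Im (c s z) * v i s)"
        by (simp add: distrib_left sum_distrib_left abs_sgn mult_ac)
      ultimately show ?thesis by linarith
    qed
  qed (use assms in auto)
qed

text \<open>A contraction in the l1 distance \<open>T\<close> of the two solutions: the resolvent
  identity and two entry bounds 1 / \<bar>Im z\<bar> give T \<le> (n^2 V / (Im z)^2) T, with a
  factor below 1.\<close>

lemma canonical_pair_eq_large_Im:
  assumes c: "canonical_pair n B v c X" and c': "canonical_pair n B v c' X'"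
    and sym: "\<And>l m. l < n \<Longrightarrow> m < n \<Longrightarrow> B l m = B m l"
    and v: "\<And>l m. 0 \<le> v l m" "\<And>l m. l < n \<Longrightarrow> m < n \<Longrightarrow> v l m \<le> V"
    and z: "(real n)\<^sup>2 * V < (Im z)\<^sup>2" "Im z \<noteq> 0" and "k < n"
  shows "c k z = c' k z"
proof -
  let ?t = "\<bar>Im z\<bar>"
  let ?A = "\<lambda>c. canonical_entries n B v (\<lambda>s. c s z) z"
  define T where "T = (\<Sum>s<n. norm (c s z - c' s z))"
  have V: "V \<ge> 0" using v(1)[of k k] v(2)[of k k] \<open>k < n\<close> by linarith
  have "T \<ge> 0" by (simp add: T_def sum_nonneg)
  have diff: "norm (c i z - c' i z) \<le> real n * (V * T / ?t\<^sup>2)" if "i < n" for i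
  proof -
    have "c i z - c' i z = X z i i - X' z i i"
      using c c' z(2) that by (simp add: canonical_pair_def)
    also have "\<dots> = (\<Sum>l<n. \<Sum>m<n. X z i l * (?A c' l m - ?A c l m) * X' z m i)"
      using c c' z(2) that by (intro inverse_entries_resolvent_identity) (auto simp: canonical_pair_def)
    \<comment> \<open>The two canonical matrices differ only on the diagonal, where \<open>z\<close>
      cancels.\<close>
    also have "\<dots> = (\<Sum>l<n. \<Sum>m<n. if l = m then
        X z i l * (\<Sum>s<n. (c s z - c' s z) * of_real (v l s)) * X' z l i else 0)"
      by (intro sum.cong) (auto simp: canonical_entries_def sum_subtractf left_diff_distrib)
    also have "\<dots> = (\<Sum>l<n. X z i l * (\<Sum>s<n. (c s z - c' s z) * of_real (v l s)) * X' z l i)"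
      by simp
    also have "norm \<dots> \<le> (\<Sum>l<n. V * T / ?t\<^sup>2)"
    proof (rule sum_norm_le)
      fix l assume "l \<in> {..<n}"
      then have l: "l < n" by simp
      have "norm (\<Sum>s<n. (c s z - c' s z) * of_real (v l s)) \<le> (\<Sum>s<n. norm (c s z - c' s z) * V)"
        using l v by (intro sum_norm_le) (auto simp: norm_mult intro!: mult_left_mono)
      also have "\<dots> = V * T" by (simp add: T_def sum_distrib_left mult.commute)
      finally have "norm (\<Sum>s<n. (c s z - c' s z) * of_real (v l s)) \<le> V * T" .
      then have "norm (X z i l * (\<Sum>s<n. (c s z - c' s z) * of_real (v l s)) * X' z l i)
          \<le> (1 / ?t) * (V * T) * (1 / ?t)"
        unfolding norm_mult using V \<open>T \<ge> 0\<close> z(2) that l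
        by (intro mult_mono canonical_pair_entry_bound[OF c sym v(1)]
              canonical_pair_entry_bound[OF c' sym v(1)]) auto
      then show "norm (X z i l * (\<Sum>s<n. (c s z - c' s z) * of_real (v l s)) * X' z l i)
          \<le> V * T / ?t\<^sup>2"
        by (simp add: power2_eq_square)
    qed
    finally show ?thesis by simp
  qed
  have "T \<le> (\<Sum>i<n. real n * (V * T / ?t\<^sup>2))"
    unfolding T_def by (rule sum_mono) (use diff in \<open>simp add: T_def\<close>)
  also have "\<dots> = T * ((real n)\<^sup>2 * V) / (Im z)\<^sup>2"
    by (simp add: power2_eq_square mult_ac)
  finally have "T * (Im z)\<^sup>2 \<le> T * ((real n)\<^sup>2 * V)"
    using z(2) by (simp add: pos_le_divide_eq)
  then have "\<not> T > 0"
    using mult_strict_left_mono[OF z(1), of T] by linarith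
  with \<open>T \<ge> 0\<close> have "T = 0" by simp
  then show ?thesis
    using \<open>k < n\<close> by (simp add: T_def sum_nonneg_eq_0_iff)
qed

text \<open>The contraction settles large \<bar>Im z\<bar>, and the identity theorem extends the
  agreement of the \<open>c s\<close> to the half plane of \<open>z\<close>. Then both inverses
  belong to the same matrix, which covers the off-diagonal entries.\<close>

lemma canonical_pair_unique:
  assumes c: "canonical_pair n B v c X" and c': "canonical_pair n B v c' X'"
    and sym: "\<And>l m. l < n \<Longrightarrow> m < n \<Longrightarrow> B l m = B m l"
    and v: "\<And>l m. 0 \<le> v l m"
    and z: "Im z \<noteq> 0" and "k < n" "j < n"
  shows "X z k j = X' z k j"
proof -
  \<comment> \<open>A crude common bound for all \<open>v l m\<close>.\<close>
  define V where "V = (\<Sum>l<n. \<Sum>m<n. v l m)"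
  have V: "v l m \<le> V" if "l < n" "m < n" for l m
  proof -
    have "v l m \<le> (\<Sum>m<n. v l m)" using that v by (intro member_le_sum) auto
    also have "\<dots> \<le> V" unfolding V_def using that v by (intro member_le_sum sum_nonneg) auto
    finally show ?thesis .
  qed
  \<comment> \<open>The summand 1 gives r \<ge> 1, so r^2 \<ge> r > n^2 V, and \<bar>Im w\<bar> > r
    puts \<open>w\<close> in the range of the contraction.\<close>
  define r where "r = (real n)\<^sup>2 * V + 1"
  have "V \<ge> 0" using v by (simp add: V_def sum_nonneg)
  then have r: "r \<ge> 1" by (simp add: r_def)
  \<comment> \<open>The sign treats both half planes at once, as the set where \<sigma> Im w is
    positive.\<close>
  define \<sigma> where "\<sigma> = sgn (Im z)"
  have \<sigma>: "\<sigma> * \<sigma> = 1" "\<sigma> * Im z > 0" using z by (auto simp: \<sigma>_def sgn_if)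
  have open_half: "open {w. a < \<sigma> * Im w}" for a
    by (intro open_Collect_less continuous_intros)
  have eq: "c s z = c' s z" if "s < n" for s
  proof (rule analytic_continuation_open[where f = "c s" and g = "c' s"
      and s = "{w. r < \<sigma> * Im w}" and s' = "{w. 0 < \<sigma> * Im w}"])
    have "Complex 0 (\<sigma> * (r + 1)) \<in> {w. r < \<sigma> * Im w}"
      using \<sigma>(1) by (simp add: mult.assoc[symmetric])
    then show "{w. r < \<sigma> * Im w} \<noteq> {}" by blast
    \<comment> \<open>The half plane is the preimage of a ray under a linear map, so it is convex
      and thus connected.\<close>
    have "{w. 0 < \<sigma> * Im w} = Im -` ((*) \<sigma> -` {0<..})" by auto
    moreover have "convex (Im -` ((*) \<sigma> -` {0<..}))"
      by (intro convex_linear_vimage bounded_linear.linear[OF bounded_linear_Im]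
          bounded_linear.linear[OF bounded_linear_mult_right]) auto
    ultimately show "connected {w. 0 < \<sigma> * Im w}" by (simp add: convex_connected)
    show "{w. r < \<sigma> * Im w} \<subseteq> {w. 0 < \<sigma> * Im w}" using r by auto
    have "{w. 0 < \<sigma> * Im w} \<subseteq> {w. Im w \<noteq> 0}" by auto
    then have "f holomorphic_on {w. 0 < \<sigma> * Im w}" if "f \<in> class_L" for f
      using that by (auto simp: class_L_def dest: analytic_imp_holomorphic intro: holomorphic_on_subset)
    then show "c s holomorphic_on {w. 0 < \<sigma> * Im w}" "c' s holomorphic_on {w. 0 < \<sigma> * Im w}"
      using c c' that by (auto simp: canonical_pair_def)
    show "c s w = c' s w" if "w \<in> {w. r < \<sigma> * Im w}" for w
    proof (rule canonical_pair_eq_large_Im[OF c c' sym v V])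
      have w: "r < \<sigma> * Im w" using that by simp
      then show "Im w \<noteq> 0" using r by auto
      have "(real n)\<^sup>2 * V < r" by (simp add: r_def)
      also have "\<dots> \<le> r * r" using mult_left_mono[OF r, of r] r by simp
      also have "\<dots> \<le> (\<sigma> * Im w) * (\<sigma> * Im w)" using w r by (intro mult_mono) auto
      also have "\<dots> = (\<sigma> * \<sigma>) * (Im w)\<^sup>2" by (simp add: power2_eq_square)
      finally show "(real n)\<^sup>2 * V < (Im w)\<^sup>2" using \<sigma> by simp
    qed (use \<open>s < n\<close> in auto)
  qed (use \<sigma> open_half in auto)
  have "canonical_entries n B v (\<lambda>s. c s z) z = canonical_entries n B v (\<lambda>s. c' s z) z"
    using eq by (simp add: canonical_entries_def fun_eq_iff)
  moreover have "inverse_entries n (canonical_entries n B v (\<lambda>s. c s z) z) (X z)"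
    "inverse_entries n (canonical_entries n B v (\<lambda>s. c' s z) z) (X' z)"
    using c c' z by (auto simp: canonical_pair_def)
  ultimately show ?thesis
    using inverse_entries_unique \<open>k < n\<close> \<open>j < n\<close> by metis
qed

text \<open>Reindexing the sum over \<open>s\<close> along \<sigma> shows that the canonical matrix
  of the relabelled solution is the relabelled canonical matrix; its inverse is relabelled in the
  same way.\<close>

lemma canonical_pair_permute:
  assumes c: "canonical_pair n B v c X" and \<sigma>: "bij_betw \<sigma> {..<n} {..<n}"
    and B: "\<And>l m. l < n \<Longrightarrow> m < n \<Longrightarrow> B (\<sigma> l) (\<sigma> m) = B l m"
    and v: "\<And>l m. l < n \<Longrightarrow> m < n \<Longrightarrow> v (\<sigma> l) (\<sigma> m) = v l m"
  shows "canonical_pair n B v (\<lambda>k. c (\<sigma> k)) (\<lambda>z l j. X z (\<sigma> l) (\<sigma> j))"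
proof -
  have \<sigma>_less: "\<sigma> l < n" if "l < n" for l using \<sigma> that by (auto dest: bij_betwE)
  have \<sigma>_eq: "\<sigma> l = \<sigma> m \<longleftrightarrow> l = m" if "l < n" "m < n" for l m
    using \<sigma> that by (auto simp: bij_betw_def inj_on_def)
  have A: "canonical_entries n B v (\<lambda>s. c (\<sigma> s) z) z l m
      = canonical_entries n B v (\<lambda>s. c s z) z (\<sigma> l) (\<sigma> m)" if "l < n" "m < n" for z l m
  proof -
    have "(\<Sum>s<n. c (\<sigma> s) z * complex_of_real (v m s))
        = (\<Sum>s<n. c (\<sigma> s) z * complex_of_real (v (\<sigma> m) (\<sigma> s)))"
      using that by (intro sum.cong) (auto simp: v)
    also have "\<dots> = (\<Sum>s<n. c s z * complex_of_real (v (\<sigma> m) s))"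
      by (rule sum.reindex_bij_betw[OF \<sigma>])
    finally show ?thesis
      using that by (simp add: canonical_entries_def B \<sigma>_eq)
  qed
  have "inverse_entries n (canonical_entries n B v (\<lambda>s. c (\<sigma> s) z) z) (\<lambda>l j. X z (\<sigma> l) (\<sigma> j))"
    if "Im z \<noteq> 0" for z
  proof -
    let ?A = "canonical_entries n B v (\<lambda>s. c s z) z"
    have inv: "inverse_entries n ?A (X z)" using c that by (simp add: canonical_pair_def)
    have "(\<Sum>m<n. ?A (\<sigma> l) (\<sigma> m) * X z (\<sigma> m) (\<sigma> j)) = (if l = j then 1 else 0)"
      "(\<Sum>m<n. X z (\<sigma> l) (\<sigma> m) * ?A (\<sigma> m) (\<sigma> j)) = (if l = j then 1 else 0)"
      if "l < n" "j < n" for l j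
      using inv that \<sigma>_less[of l] \<sigma>_less[of j] \<sigma>_eq[of l j]
        sum.reindex_bij_betw[OF \<sigma>, of "\<lambda>m. ?A (\<sigma> l) m * X z m (\<sigma> j)"]
        sum.reindex_bij_betw[OF \<sigma>, of "\<lambda>m. X z (\<sigma> l) m * ?A m (\<sigma> j)"]
      by (simp_all add: inverse_entries_def)
    then show ?thesis by (simp add: inverse_entries_def A)
  qed
  then show ?thesis
    using c \<sigma>_less by (simp add: canonical_pair_def)
qed

section \<open>Automorphisms of the lattice\<close>

text \<open>The invariant that classifies pairs of nodes under symbol permutations: a singleton
  \<open>{d}\<close> with \<open>d < D\<close> marks a link along dimension \<open>d\<close>, the
  empty set marks equal nodes.\<close>

definition differing_dims :: "(nat \<Rightarrow> nat) \<Rightarrow> nat \<Rightarrow> nat \<Rightarrow> nat \<Rightarrow> nat set" where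
  "differing_dims M D l j = {e. e < D \<and> coord M D e l \<noteq> coord M D e j}"

text \<open>First swap \<open>a\<close> with \<open>a'\<close>, then swap the image of
  \<open>b\<close> with \<open>b'\<close>. The second swap fixes \<open>a'\<close>: it is the
  identity if \<open>a = b\<close>, and otherwise neither swapped symbol is
  \<open>a'\<close>.\<close>

lemma permutation_of_pair:
  fixes a b a' b' m :: nat
  assumes "a < m" "b < m" "a' < m" "b' < m" "a = b \<longleftrightarrow> a' = b'"
  obtains \<pi> where "inj \<pi>" "\<And>x. x < m \<Longrightarrow> \<pi> x < m" "\<pi> a = a'" "\<pi> b = b'"
proof
  let ?\<tau> = "Transposition.transpose a a'"
  let ?\<pi> = "Transposition.transpose (?\<tau> b) b' \<circ> ?\<tau>"
  show "inj ?\<pi>" by (intro inj_compose) (simp_all add: bij_is_inj)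
  show "?\<pi> x < m" if "x < m" for x
    using that assms by (auto simp: Transposition.transpose_def)
  show "?\<pi> a = a'" using assms by (auto simp: Transposition.transpose_def)
  show "?\<pi> b = b'" by simp
qed

text \<open>Equal difference sets mean that in every dimension some symbol permutation carries the
  two digits of the first pair to those of the second. Applying these digit by digit gives
  \<sigma>.\<close>

lemma lattice_automorphism_of_pair:
  assumes pos: "\<And>d. d < D \<Longrightarrow> M d > 0" and N: "N = (\<Prod>d<D. M d)"
    and S: "differing_dims M D l j = differing_dims M D l' j'"
    and less: "l < N" "j < N" "l' < N" "j' < N"
  obtains \<sigma> where "bij_betw \<sigma> {..<N} {..<N}" "\<sigma> l = l'" "\<sigma> j = j'"
    "\<And>k i. k < N \<Longrightarrow> i < N \<Longrightarrow> differing_dims M D (\<sigma> k) (\<sigma> i) = differing_dims M D k i"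
proof -
  have "\<exists>\<pi>. inj \<pi> \<and> (\<forall>x<M d. \<pi> x < M d) \<and>
      \<pi> (coord M D d l) = coord M D d l' \<and> \<pi> (coord M D d j) = coord M D d j'" if "d < D" for d
  proof -
    have "coord M D d l = coord M D d j \<longleftrightarrow> coord M D d l' = coord M D d j'"
      using S that by (auto simp: differing_dims_def)
    with permutation_of_pair[of "coord M D d l" "M d" "coord M D d j" "coord M D d l'" "coord M D d j'"]
    show ?thesis using that pos coord_less by metis
  qed
  then obtain \<pi> where \<pi>: "\<And>d. d < D \<Longrightarrow> inj (\<pi> d)" "\<And>d x. d < D \<Longrightarrow> x < M d \<Longrightarrow> \<pi> d x < M d"
    "\<And>d. d < D \<Longrightarrow> \<pi> d (coord M D d l) = coord M D d l'"
    "\<And>d. d < D \<Longrightarrow> \<pi> d (coord M D d j) = coord M D d j'"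
    by metis
  \<comment> \<open>Every tuple of admissible digits is the digit tuple of some node.\<close>
  have "\<exists>i<N. \<forall>d<D. coord M D d i = \<pi> d (coord M D d k)" for k
  proof -
    let ?x = "\<lambda>d\<in>{..<D}. \<pi> d (coord M D d k)"
    have "?x \<in> (\<Pi>\<^sub>E d\<in>{..<D}. {..<M d})" using \<pi>(2) pos by (auto simp: coord_less)
    then have "?x \<in> (\<lambda>k. \<lambda>d\<in>{..<D}. coord M D d k) ` {..<N}"
      using bij_betw_imp_surj_on[OF bij_betw_coord[of D M, OF pos]] N by simp
    then obtain i where i: "?x = (\<lambda>d\<in>{..<D}. coord M D d i)" "i \<in> {..<N}"
      by (rule imageE)
    have "coord M D d i = \<pi> d (coord M D d k)" if "d < D" for d
      using fun_cong[OF i(1), of d] that by simp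
    with i(2) show ?thesis by blast
  qed
  then obtain \<sigma> where \<sigma>: "\<And>k. \<sigma> k < N"
    "\<And>k d. d < D \<Longrightarrow> coord M D d (\<sigma> k) = \<pi> d (coord M D d k)"
    by metis
  have dims: "differing_dims M D (\<sigma> k) (\<sigma> i) = differing_dims M D k i" for k i
    using \<sigma>(2) \<pi>(1) by (auto simp: differing_dims_def inj_eq)
  \<comment> \<open>Equal images have an empty difference set, so the original digits agree. Being
    injective on a finite set into itself, \<sigma> is then onto.\<close>
  have "inj_on \<sigma> {..<N}"
  proof (rule inj_onI)
    fix k i assume "k \<in> {..<N}" "i \<in> {..<N}" "\<sigma> k = \<sigma> i"
    moreover from this have "differing_dims M D k i = {}"
      using dims[of k i] by (simp add: differing_dims_def)
    ultimately show "k = i" using N by (intro coord_eqI[of k M D i]) (auto simp: differing_dims_def)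
  qed
  moreover from this have "\<sigma> ` {..<N} = {..<N}"
    using \<sigma>(1) by (intro endo_inj_surj) auto
  ultimately have "bij_betw \<sigma> {..<N} {..<N}" by (simp add: bij_betw_def)
  moreover have "\<sigma> l = l'" "\<sigma> j = j'"
    by (rule coord_eqI[of _ M D]; use \<sigma> \<pi>(3,4) less N in simp)+
  ultimately show ?thesis using dims that by blast
qed

section \<open>Moments of the percolated adjacency matrix\<close>

text \<open>The set \<open>G \<omega>\<close> contains only lattice links, and {l, j} is a link
  along \<open>d\<close> exactly when the difference set is \<open>{d}\<close>. All other pairs have
  the empty event.\<close>

lemma lattice_percolation_prob:
  assumes perc: "lattice_percolation P M D p G" and "l < (\<Prod>d<D. M d)" "j < (\<Prod>d<D. M d)"
  shows "{\<omega> \<in> space P. {l, j} \<in> G \<omega>} \<in> sets P"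
    and "measure P {\<omega> \<in> space P. {l, j} \<in> G \<omega>} =
      (if \<exists>d<D. differing_dims M D l j = {d} then p (the_elem (differing_dims M D l j)) else 0)"
proof -
  interpret prob_space P using perc by (simp add: lattice_percolation_def)
  let ?Q = "{\<omega> \<in> space P. {l, j} \<in> G \<omega>}"
  have links: "{l, j} \<in> lattice_links M D d \<longleftrightarrow> differing_dims M D l j = {d}" for d
    using assms(2,3) by (simp add: doubleton_in_lattice_links differing_dims_def)
  have empty: "?Q = {}" if "\<nexists>d. d < D \<and> differing_dims M D l j = {d}"
    using perc that unfolding lattice_percolation_def links[symmetric] by blast
  have "?Q \<in> sets P" if "d < D" "differing_dims M D l j = {d}" for d
  proof -
    have "{l, j} \<in> (\<Union>d<D. lattice_links M D d)" using links[of d] that by blast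
    \<comment> \<open>Measurability is part of \<open>indep_events\<close>.\<close>
    then show ?thesis
      using perc unfolding lattice_percolation_def indep_events_def image_subset_iff by blast
  qed
  then show "?Q \<in> sets P" using empty by (metis sets.empty_sets)
  show "measure P ?Q =
      (if \<exists>d<D. differing_dims M D l j = {d} then p (the_elem (differing_dims M D l j)) else 0)"
  proof (cases "\<exists>d<D. differing_dims M D l j = {d}")
    case True
    then obtain d where d: "d < D" "differing_dims M D l j = {d}" by blast
    then have "measure P ?Q = p d"
      using perc links[of d] by (simp add: lattice_percolation_def)
    then show ?thesis using d by auto
  next
    case False
    then have "?Q = {}" using empty by blast
    with False show ?thesis by (simp only: measure_empty if_False)
  qed
qed

lemma (in prob_space) indicator_moments:
  fixes a b :: real
  assumes "Q \<in> events"
  shows "(\<integral>\<omega>. a * indicator Q \<omega> \<partial>M) = a * prob Q"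
    and "(\<integral>\<omega>. (a * indicator Q \<omega> - b)\<^sup>2 \<partial>M) = (a\<^sup>2 - 2 * a * b) * prob Q + b\<^sup>2"
proof -
  show "(\<integral>\<omega>. a * indicator Q \<omega> \<partial>M) = a * prob Q"
    using assms by (simp add: Int_absorb2 sets.sets_into_space)
  have "(a * indicator Q \<omega> - b)\<^sup>2 = (a\<^sup>2 - 2 * a * b) * indicator Q \<omega> + b\<^sup>2" for \<omega>
    by (auto simp: indicator_def power2_diff)
  moreover have "(\<integral>\<omega>. (a\<^sup>2 - 2 * a * b) * indicator Q \<omega> + b\<^sup>2 \<partial>M)
      = (a\<^sup>2 - 2 * a * b) * prob Q + b\<^sup>2"
    using assms
    by (subst Bochner_Integration.integral_add)
       (auto simp: Int_absorb2 sets.sets_into_space prob_space emeasure_eq_measure)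
  ultimately show "(\<integral>\<omega>. (a * indicator Q \<omega> - b)\<^sup>2 \<partial>M) = (a\<^sup>2 - 2 * a * b) * prob Q + b\<^sup>2"
    by presburger
qed

text \<open>Each entry of \<open>W\<close> is \<open>a\<close> times the indicator of a link event,
  so its mean and variance are functions of the link probability, which depends only on the
  difference set.\<close>

lemma lattice_percolation_moments:
  assumes perc: "lattice_percolation P M D p G" and N: "N = (\<Prod>d<D. M d)"
    and W: "W = (\<lambda>\<omega>. a \<cdot>\<^sub>m adjacency_mat N (G \<omega>))" and B: "B = expectation_mat P N W"
  obtains \<beta> \<nu> where
    "\<And>l j. l < N \<Longrightarrow> j < N \<Longrightarrow> B $$ (l, j) = \<beta> (differing_dims M D l j)"
    "\<And>l j. l < N \<Longrightarrow> j < N \<Longrightarrow>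
      (\<integral>\<omega>. ((W \<omega> - B) $$ (l, j))\<^sup>2 \<partial>P) = \<nu> (differing_dims M D l j)"
proof -
  interpret prob_space P using perc by (simp add: lattice_percolation_def)
  define q where "q S = (if \<exists>d<D. S = {d} then p (the_elem S) else 0)" for S
  let ?Q = "\<lambda>l j. {\<omega> \<in> space P. {l, j} \<in> G \<omega>}"
  have Q: "?Q l j \<in> events" "prob (?Q l j) = q (differing_dims M D l j)" if "l < N" "j < N" for l j
    using lattice_percolation_prob[OF perc, of l j] that by (simp_all add: N q_def)
  have W_entry: "W \<omega> $$ (l, j) = a * indicator (?Q l j) \<omega>"
    if "\<omega> \<in> space P" "l < N" "j < N" for \<omega> l j
    using that by (simp add: W adjacency_mat_def)
  have B_entry: "B $$ (l, j) = a * q (differing_dims M D l j)" if "l < N" "j < N" for l j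
  proof -
    have "B $$ (l, j) = (\<integral>\<omega>. W \<omega> $$ (l, j) \<partial>P)"
      using that by (simp add: B expectation_mat_def)
    also have "\<dots> = (\<integral>\<omega>. a * indicator (?Q l j) \<omega> \<partial>P)"
      using that by (intro Bochner_Integration.integral_cong) (auto simp: W_entry)
    finally show ?thesis using that by (simp only: indicator_moments Q)
  qed
  show ?thesis
  proof
    show "B $$ (l, j) = a * q (differing_dims M D l j)" if "l < N" "j < N" for l j
      using that by (rule B_entry)
    show "(\<integral>\<omega>. ((W \<omega> - B) $$ (l, j))\<^sup>2 \<partial>P) =
        (a\<^sup>2 - 2 * a * (a * q (differing_dims M D l j))) * q (differing_dims M D l j)
          + (a * q (differing_dims M D l j))\<^sup>2"
      if "l < N" "j < N" for l j
    proof -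
      have "(\<integral>\<omega>. ((W \<omega> - B) $$ (l, j))\<^sup>2 \<partial>P)
          = (\<integral>\<omega>. (a * indicator (?Q l j) \<omega> - a * q (differing_dims M D l j))\<^sup>2 \<partial>P)"
        using that B_entry W_entry
        by (intro Bochner_Integration.integral_cong) (auto simp: B expectation_mat_def)
      then show ?thesis using that by (simp only: indicator_moments Q)
    qed
  qed
qed

section \<open>Kronecker form of invariant matrices\<close>

lemma mat_inverse_invertible:
  fixes A :: "'a::field mat"
  assumes "A \<in> carrier_mat n n" "invertible_mat A"
  shows "A * the (mat_inverse A) = 1\<^sub>m n" "the (mat_inverse A) * A = 1\<^sub>m n"
    "the (mat_inverse A) \<in> carrier_mat n n"
proof -
  obtain X where "A * X = 1\<^sub>m n" "X * A = 1\<^sub>m (dim_row X)"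
    using assms by (auto simp: invertible_mat_def inverts_mat_def)
  moreover from this have "X \<in> carrier_mat n n"
    using assms(1) by (metis carrier_matI carrier_matD index_mult_mat(2,3) index_one_mat(2,3))
  \<comment> \<open>A two-sided inverse makes \<open>A\<close> a unit of the matrix ring, which
    rules out the result \<open>None\<close> of \<open>mat_inverse\<close>.\<close>
  ultimately have "A \<in> Units (ring_mat TYPE('a) n n)"
    using assms(1) by (auto simp: Units_def ring_mat_def)
  then obtain Y where "mat_inverse A = Some Y"
    using mat_inverse(1)[OF assms(1), where b = n] by (cases "mat_inverse A") auto
  then show "A * the (mat_inverse A) = 1\<^sub>m n" "the (mat_inverse A) * A = 1\<^sub>m n"
    "the (mat_inverse A) \<in> carrier_mat n n"
    using mat_inverse(2)[OF assms(1)] by auto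
qed

lemma canonical_solution_imp_pair:
  assumes sol: "canonical_solution P n B H c" and B: "B \<in> carrier_mat n n"
  defines "v \<equiv> \<lambda>l j. \<integral>\<omega>. (H \<omega> $$ (l, j))\<^sup>2 \<partial>P"
    and "X \<equiv> \<lambda>z. the (mat_inverse (canonical_mat P n B H c z))"
  shows "canonical_pair n (\<lambda>l j. B $$ (l, j)) v c (\<lambda>z l j. X z $$ (l, j))"
    and "Im z \<noteq> 0 \<Longrightarrow> X z \<in> carrier_mat n n"
proof -
  let ?A = "canonical_mat P n B H c"
  have A: "?A z \<in> carrier_mat n n" for z
    unfolding canonical_mat_def by (rule minus_carrier_mat) simp
  have entry: "?A z $$ (l, j) =
      canonical_entries n (\<lambda>l j. B $$ (l, j)) v (\<lambda>s. c s z) z l j" if "l < n" "j < n" for z l j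
    using that B by (simp add: canonical_mat_def canonical_entries_def v_def)
  have X: "?A z * X z = 1\<^sub>m n" "X z * ?A z = 1\<^sub>m n" "X z \<in> carrier_mat n n" if "Im z \<noteq> 0" for z
    using mat_inverse_invertible[OF A, of z] sol that by (simp_all add: canonical_solution_def X_def)
  have "inverse_entries n (canonical_entries n (\<lambda>l j. B $$ (l, j)) v (\<lambda>s. c s z) z)
      (\<lambda>l j. X z $$ (l, j))" if "Im z \<noteq> 0" for z
    unfolding inverse_entries_def
  proof (intro allI impI conjI)
    fix l j assume lj: "l < n" "j < n"
    have mult: "(Y * Z) $$ (l, j) = (\<Sum>m<n. Y $$ (l, m) * Z $$ (m, j))"
      if "Y \<in> carrier_mat n n" "Z \<in> carrier_mat n n" for Y Z :: "complex mat"
      using that lj by (simp add: scalar_prod_def lessThan_atLeast0)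
    show "(\<Sum>m<n. canonical_entries n (\<lambda>l j. B $$ (l, j)) v (\<lambda>s. c s z) z l m * X z $$ (m, j))
        = (if l = j then 1 else 0)"
      using mult[OF A X(3)[OF that], of z] X(1)[OF that] lj by (simp add: entry)
    show "(\<Sum>m<n. X z $$ (l, m) * canonical_entries n (\<lambda>l j. B $$ (l, j)) v (\<lambda>s. c s z) z m j)
        = (if l = j then 1 else 0)"
      using mult[OF X(3)[OF that] A, of z] X(2)[OF that] lj by (simp add: entry)
  qed
  then show "canonical_pair n (\<lambda>l j. B $$ (l, j)) v c (\<lambda>z l j. X z $$ (l, j))"
    using sol by (simp add: canonical_pair_def canonical_solution_def X_def)
  show "Im z \<noteq> 0 \<Longrightarrow> X z \<in> carrier_mat n n" by (rule X(3))
qed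

text \<open>A factor K contributes 1 where the digits differ, a factor I where they agree. So the
  product for \<open>i\<close> is the 0/1 indicator of the pairs with difference set
  \<open>{d. d < D \<and> i d = 0}\<close>, and at each position exactly one summand
  survives.\<close>

lemma mat_sum_kron_prod_of_differing_dims:
  fixes X :: "'a::comm_semiring_1 mat"
  assumes pos: "\<And>d. d < D \<Longrightarrow> M d > 0" and N: "N = (\<Prod>d<D. M d)" and X: "X \<in> carrier_mat N N"
    and f: "\<And>l j. l < N \<Longrightarrow> j < N \<Longrightarrow> X $$ (l, j) = f (differing_dims M D l j)"
  shows "X = mat_sum N ({..<D} \<rightarrow>\<^sub>E {0, 1 :: nat})
    (\<lambda>i. f {d. d < D \<and> i d = 0} \<cdot>\<^sub>m
      kron_prod (\<lambda>d. if i d = 0 then complete_adj (M d) else 1\<^sub>m (M d)) D)"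
    (is "X = mat_sum N ?I (\<lambda>i. ?f i \<cdot>\<^sub>m kron_prod (?Y i) D)")
proof (rule eq_matI)
  fix l j assume "l < dim_row (mat_sum N ?I (\<lambda>i. ?f i \<cdot>\<^sub>m kron_prod (?Y i) D))"
    "j < dim_col (mat_sum N ?I (\<lambda>i. ?f i \<cdot>\<^sub>m kron_prod (?Y i) D))"
  then have lj: "l < N" "j < N" by (simp_all add: mat_sum_def)
  \<comment> \<open>The index of the surviving summand; the restriction to \<open>{..<D}\<close>
    makes it extensional, as membership in the index set requires.\<close>
  define i\<^sub>0 :: "nat \<Rightarrow> nat" where
    "i\<^sub>0 = (\<lambda>d\<in>{..<D}. if d \<in> differing_dims M D l j then 0 else 1)"
  have Y: "?Y i d \<in> carrier_mat (M d) (M d)" for i :: "nat \<Rightarrow> nat" and d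
    by (simp add: complete_adj_def)
  have car: "kron_prod (?Y i) D \<in> carrier_mat N N" for i :: "nat \<Rightarrow> nat"
    unfolding N by (rule dim_kron_prod) (rule Y)
  have entry: "kron_prod (?Y i) D $$ (l, j) = (if i = i\<^sub>0 then 1 else 0)" if "i \<in> ?I" for i
  proof -
    have "kron_prod (?Y i) D $$ (l, j) = (\<Prod>d<D. ?Y i d $$ (coord M D d l, coord M D d j))"
      by (rule kron_prod_entry) (use lj N Y in auto)
    also have "\<dots> = (\<Prod>d<D. if i d = i\<^sub>0 d then 1 else 0)"
    proof (rule prod.cong)
      fix d assume "d \<in> {..<D}"
      then have "i d = 0 \<or> i d = 1" using that by auto
      with \<open>d \<in> {..<D}\<close> show "?Y i d $$ (coord M D d l, coord M D d j) = (if i d = i\<^sub>0 d then 1 else 0)"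
        by (auto simp: complete_adj_def coord_less pos i\<^sub>0_def differing_dims_def)
    qed simp
    also have "\<dots> = (if i = i\<^sub>0 then 1 else 0)"
    proof (cases "i = i\<^sub>0")
      case False
      have "i\<^sub>0 \<in> ?I" by (auto simp: i\<^sub>0_def)
      with False that obtain d where "d < D" "i d \<noteq> i\<^sub>0 d"
        by (metis PiE_ext lessThan_iff)
      then have "(\<Prod>d<D. if i d = i\<^sub>0 d then 1 else 0 :: 'a) = 0"
        by (intro prod_zero) auto
      with False show ?thesis by simp
    qed simp
    finally show ?thesis .
  qed
  have "i\<^sub>0 \<in> ?I" by (auto simp: i\<^sub>0_def)
  moreover have "finite ?I" by (intro finite_PiE) auto
  moreover have "{d. d < D \<and> i\<^sub>0 d = 0} = differing_dims M D l j"
    by (auto simp: i\<^sub>0_def differing_dims_def)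
  moreover have "mat_sum N ?I (\<lambda>i. ?f i \<cdot>\<^sub>m kron_prod (?Y i) D) $$ (l, j)
      = (\<Sum>i\<in>?I. if i = i\<^sub>0 then ?f i else 0)"
  proof -
    have "(?f i \<cdot>\<^sub>m kron_prod (?Y i) D) $$ (l, j) = (if i = i\<^sub>0 then ?f i else 0)" if "i \<in> ?I" for i
      using car[of i] lj entry[OF that] by (subst index_smult_mat) auto
    then show ?thesis using lj unfolding mat_sum_def by (auto intro!: sum.cong)
  qed
  ultimately show "X $$ (l, j) = mat_sum N ?I (\<lambda>i. ?f i \<cdot>\<^sub>m kron_prod (?Y i) D) $$ (l, j)"
    using f[OF lj] by simp
qed (use X in \<open>simp_all add: mat_sum_def\<close>)

section \<open>Invariance of \<open>C z\<close> and the choice of the coefficients\<close>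

theorem theorem2:
  fixes D N :: nat and M :: "nat \<Rightarrow> nat" and p :: "nat \<Rightarrow> real" and \<gamma> :: real
    and P :: "'w measure" and G :: "'w \<Rightarrow> nat set set"
    and W H :: "'w \<Rightarrow> real mat" and B :: "real mat"
    and c :: "nat \<Rightarrow> complex \<Rightarrow> complex" and C :: "complex \<Rightarrow> complex mat"
  assumes "D \<ge> 1"
    and "\<And>d. d < D \<Longrightarrow> M d \<ge> 1"
    and "N = (\<Prod>d<D. M d)"
    and "\<And>d. d < D \<Longrightarrow> p d \<in> {0..1}"
    and "\<gamma> = (\<Sum>d<D. p d * (real (M d) - 1))"
    and "\<gamma> > 0"
    and "lattice_percolation P M D p G"
    and "W = (\<lambda>\<omega>. (1 / \<gamma>) \<cdot>\<^sub>m adjacency_mat N (G \<omega>))"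
    and "B = expectation_mat P N W"
    and "H = (\<lambda>\<omega>. W \<omega> - B)"
    and "canonical_solution P N B H c"
    and "C = (\<lambda>z. the (mat_inverse (canonical_mat P N B H c z)))"
  shows "\<exists>\<alpha> :: (nat \<Rightarrow> nat) \<Rightarrow> complex \<Rightarrow> complex. \<forall>z. Im z \<noteq> 0 \<longrightarrow>
    C z = mat_sum N ({..<D} \<rightarrow>\<^sub>E {0, 1})
            (\<lambda>i. \<alpha> i z \<cdot>\<^sub>m kron_prod (\<lambda>d. if i d = 0 then complete_adj (M d) else 1\<^sub>m (M d)) D)"
proof -
  note N = assms(3) and perc = assms(7) and H = assms(10) and sol = assms(11) and C = assms(12)
  have pos: "M d > 0" if "d < D" for d using assms(2)[OF that] by simp
  have B_car: "B \<in> carrier_mat N N" using assms(9) by (simp add: expectation_mat_def)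
  obtain \<beta> \<nu> where
    \<beta>: "\<And>l j. l < N \<Longrightarrow> j < N \<Longrightarrow> B $$ (l, j) = \<beta> (differing_dims M D l j)" and
    \<nu>: "\<And>l j. l < N \<Longrightarrow> j < N \<Longrightarrow> (\<integral>\<omega>. (H \<omega> $$ (l, j))\<^sup>2 \<partial>P) = \<nu> (differing_dims M D l j)"
    using lattice_percolation_moments[OF perc N assms(8,9)] unfolding H by blast
  let ?v = "\<lambda>l j. \<integral>\<omega>. (H \<omega> $$ (l, j))\<^sup>2 \<partial>P"
  have pair: "canonical_pair N (\<lambda>l j. B $$ (l, j)) ?v c (\<lambda>z l j. C z $$ (l, j))"
    and C_car: "\<And>z. Im z \<noteq> 0 \<Longrightarrow> C z \<in> carrier_mat N N"
    using canonical_solution_imp_pair[OF sol B_car] by (simp_all add: C)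
  \<comment> \<open>This makes \<open>B\<close> symmetric, as the uniqueness result demands.\<close>
  have dims_commute: "differing_dims M D l j = differing_dims M D j l" for l j
    by (auto simp: differing_dims_def)
  \<comment> \<open>Relabelling by an automorphism that carries one pair to the other yields a
    second solution; uniqueness equates the two inverses at \<open>(l, j)\<close>.\<close>
  have inv: "C z $$ (l, j) = C z $$ (l', j')"
    if z: "Im z \<noteq> 0" and less: "l < N" "j < N" "l' < N" "j' < N"
      and S: "differing_dims M D l j = differing_dims M D l' j'" for z l j l' j'
  proof -
    from lattice_automorphism_of_pair[OF pos N S less] obtain \<sigma> where
      \<sigma>: "bij_betw \<sigma> {..<N} {..<N}" "\<sigma> l = l'" "\<sigma> j = j'"
        "\<And>k i. k < N \<Longrightarrow> i < N \<Longrightarrow> differing_dims M D (\<sigma> k) (\<sigma> i) = differing_dims M D k i"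
      by blast
    have \<sigma>_less: "\<sigma> k < N" if "k < N" for k using \<sigma>(1) that by (auto dest: bij_betwE)
    have "canonical_pair N (\<lambda>l j. B $$ (l, j)) ?v (\<lambda>k. c (\<sigma> k)) (\<lambda>z l j. C z $$ (\<sigma> l, \<sigma> j))"
      by (rule canonical_pair_permute[OF pair \<sigma>(1)]) (simp_all add: \<beta> \<nu> \<sigma>(4) \<sigma>_less)
    from canonical_pair_unique[OF pair this _ _ z less(1,2)]
    show ?thesis by (simp add: \<beta> dims_commute \<sigma>(2,3))
  qed
  \<comment> \<open>The common entry on the pairs with difference set \<open>S\<close>. If no pair
    has this set, as when \<open>M d = 1\<close> for some \<open>d\<close> in \<open>S\<close>, the
    value is arbitrary and the corresponding Kronecker product is zero.\<close>
  define f where "f z S = (SOME x. \<exists>l<N. \<exists>j<N. differing_dims M D l j = S \<and> x = C z $$ (l, j))" for z S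
  have f: "C z $$ (l, j) = f z (differing_dims M D l j)" if "Im z \<noteq> 0" "l < N" "j < N" for z l j
  proof -
    have "\<exists>x. \<exists>l'<N. \<exists>j'<N. differing_dims M D l' j' = differing_dims M D l j \<and> x = C z $$ (l', j')"
      using that by blast
    from someI_ex[OF this] show ?thesis
      using inv[OF that] unfolding f_def by metis
  qed
  show ?thesis
    by (rule exI[of _ "\<lambda>i z. f z {d. d < D \<and> i d = 0}"], intro allI impI,
        rule mat_sum_kron_prod_of_differing_dims[OF pos N C_car f])
qed

end
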